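(* For any positive integers $r,p,q$, the joint flag category $\mathscr J_{r,p,q}$ and the double flag category $\mathscr D_{r,p,q}$ are equivalent categories.
   Context: The base field $\Bbbk$ is algebraically closed of characteristic zero. Let $Q_{r,p,q}$ be the quiver with vertices $\delta$, $\alpha_1,\dots,\alpha_{r-1}$, $\beta_1,\dots,\beta_{p-1}$, $\gamma_1,\dots,\gamma_{q-1}$ and arrows forming three arms $\alpha_1\to\cdots\to\alpha_{r-1}\to\delta$, $\beta_1\to\cdots\to\beta_{p-1}\to\delta$, $\gamma_1\to\cdots\to\gamma_{q-1}\to\delta$. Consider its category of finite-dimensional representations over $\Bbbk$. The joint flag category $\mathscr J_{r,p,q}$ is the full subcategory whose objects are the representations $(V,A,B,C)$ (with $V$ at $\delta$ and $A_i,B_i,C_i$ at $\alpha_i,\beta_i,\gamma_i$) such that all maps are injective and $\operatorname{Im}\alpha\oplus\operatorname{Im}\beta=V$, where $\alpha:B_{p-1}\to V$ and $\beta:C_{q-1}\to V$ are the last maps of the second and third arms (with $B_0=0$, resp. $C_0=0$, if $p=1$, resp. $q=1$). The double flag category $\mathscr D_{r,p,q}$ is the full subcategory of $\mathscr J_{r,p,q}$ whose objects are those for which the space at $\delta$ is an (external) direct sum $V_1=V_2\oplus V_3$, the space at $\beta_{p-1}$ is $B_{p-1}=V_2$ with map $\binom{1}{0}:V_2\to V_2\oplus V_3$, the space at $\gamma_{q-1}$ is $C_{q-1}=V_3$ with map $\binom{0}{1}:V_3\to V_2\oplus V_3$, and $(A,B,C)$ is a triple of flags in $V_1,V_2,V_3$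 respectively, i.e. $A_1\subset\cdots\subset A_{r-1}\subset V_1$, $B_1\subset\cdots\subset B_{p-1}=V_2$, $C_1\subset\cdots\subset C_{q-1}=V_3$ (arbitrary dimensions, equalities allowed), with the remaining arrows given by the inclusions. *)

theory Defs
  imports "Jordan_Normal_Form.VS_Connect" "Graph_Theory.Digraph"
begin

section \<open>Categories and equivalence of categories\<close>

text \<open>Hom-sets of different pairs of objects need not be disjoint. Composition and the action of a
  functor on morphisms therefore take the objects involved as arguments.\<close>

record ('o, 'm) category =
  Obj :: "'o set"
  Hom :: "'o \<Rightarrow> 'o \<Rightarrow> 'm set"
  Ident :: "'o \<Rightarrow> 'm"
  Comp :: "'o \<Rightarrow> 'o \<Rightarrow> 'o \<Rightarrow> 'm \<Rightarrow> 'm \<Rightarrow> 'm" \<comment> \<open>\<open>Comp C X Y Z g f\<close> is \<open>g \<circ> f : X \<rightarrow> Y \<rightarrow> Z\<close>\<close>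

locale category =
  fixes C :: "('o, 'm) category"
  assumes ident_in_Hom: "X \<in> Obj C \<Longrightarrow> Ident C X \<in> Hom C X X"
    and comp_in_Hom: "\<lbrakk>X \<in> Obj C; Y \<in> Obj C; Z \<in> Obj C; f \<in> Hom C X Y; g \<in> Hom C Y Z\<rbrakk>
      \<Longrightarrow> Comp C X Y Z g f \<in> Hom C X Z"
    and comp_ident_right: "\<lbrakk>X \<in> Obj C; Y \<in> Obj C; f \<in> Hom C X Y\<rbrakk>
      \<Longrightarrow> Comp C X X Y f (Ident C X) = f"
    and comp_ident_left: "\<lbrakk>X \<in> Obj C; Y \<in> Obj C; f \<in> Hom C X Y\<rbrakk>
      \<Longrightarrow> Comp C X Y Y (Ident C Y) f = f"
    and comp_assoc: "\<lbrakk>W \<in> Obj C; X \<in> Obj C; Y \<in> Obj C; Z \<in> Obj C;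
        f \<in> Hom C W X; g \<in> Hom C X Y; h \<in> Hom C Y Z\<rbrakk>
      \<Longrightarrow> Comp C W Y Z h (Comp C W X Y g f) = Comp C W X Z (Comp C X Y Z h g) f"

definition full_subcategory :: "('o, 'm) category \<Rightarrow> ('o \<Rightarrow> bool) \<Rightarrow> ('o, 'm) category" where
  "full_subcategory C P = C\<lparr>Obj := {X \<in> Obj C. P X}\<rparr>"

locale covariant_functor = C: category C + D: category D
  for C :: "('o, 'm) category" and D :: "('o', 'm') category" +
  fixes Fo :: "'o \<Rightarrow> 'o'" and Fm :: "'o \<Rightarrow> 'o \<Rightarrow> 'm \<Rightarrow> 'm'"
  assumes obj_map: "X \<in> Obj C \<Longrightarrow> Fo X \<in> Obj D"
    and mor_map: "\<lbrakk>X \<in> Obj C; Y \<in> Obj C; f \<in> Hom C X Y\<rbrakk> \<Longrightarrow> Fm X Y f \<in> Hom D (Fo X) (Fo Y)"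
    and map_ident: "X \<in> Obj C \<Longrightarrow> Fm X X (Ident C X) = Ident D (Fo X)"
    and map_comp: "\<lbrakk>X \<in> Obj C; Y \<in> Obj C; Z \<in> Obj C; f \<in> Hom C X Y; g \<in> Hom C Y Z\<rbrakk>
      \<Longrightarrow> Fm X Z (Comp C X Y Z g f) = Comp D (Fo X) (Fo Y) (Fo Z) (Fm Y Z g) (Fm X Y f)"

definition isomorphism_in :: "('o, 'm) category \<Rightarrow> 'o \<Rightarrow> 'o \<Rightarrow> 'm \<Rightarrow> bool" where
  "isomorphism_in C X Y f \<longleftrightarrow> f \<in> Hom C X Y \<and>
     (\<exists>g \<in> Hom C Y X. Comp C X Y X g f = Ident C X \<and> Comp C Y X Y f g = Ident C Y)"

text \<open>\<open>\<eta>\<close> is a natural isomorphism from the functor \<open>(Fo, Fm)\<close> to the functor \<open>(Go, Gm)\<close>,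
  both from \<open>C\<close> to \<open>D\<close>.\<close>

definition natural_isomorphism ::
  "('o, 'm) category \<Rightarrow> ('o', 'm') category \<Rightarrow> ('o \<Rightarrow> 'o') \<Rightarrow> ('o \<Rightarrow> 'o \<Rightarrow> 'm \<Rightarrow> 'm') \<Rightarrow>
   ('o \<Rightarrow> 'o') \<Rightarrow> ('o \<Rightarrow> 'o \<Rightarrow> 'm \<Rightarrow> 'm') \<Rightarrow> ('o \<Rightarrow> 'm') \<Rightarrow> bool" where
  "natural_isomorphism C D Fo Fm Go Gm \<eta> \<longleftrightarrow>
     (\<forall>X \<in> Obj C. isomorphism_in D (Fo X) (Go X) (\<eta> X)) \<and>
     (\<forall>X \<in> Obj C. \<forall>Y \<in> Obj C. \<forall>f \<in> Hom C X Y.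
        Comp D (Fo X) (Fo Y) (Go Y) (\<eta> Y) (Fm X Y f) =
        Comp D (Fo X) (Go X) (Go Y) (Gm X Y f) (\<eta> X))"

definition equivalent_categories :: "('o, 'm) category \<Rightarrow> ('o', 'm') category \<Rightarrow> bool" where
  "equivalent_categories C D \<longleftrightarrow>
     (\<exists>Fo Fm Go Gm \<eta> \<epsilon>.
        covariant_functor C D Fo Fm \<and> covariant_functor D C Go Gm \<and>
        natural_isomorphism C C (\<lambda>X. X) (\<lambda>X Y f. f)
          (\<lambda>X. Go (Fo X)) (\<lambda>X Y f. Gm (Fo X) (Fo Y) (Fm X Y f)) \<eta> \<and>
        natural_isomorphism D D (\<lambda>X. Fo (Go X)) (\<lambda>X Y f. Fm (Go X) (Go Y) (Gm X Y f))
          (\<lambda>X. X) (\<lambda>X Y f. f) \<epsilon>)"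


section \<open>Vector spaces in a universe closed under pairing\<close>

text \<open>The carriers of all vector spaces are sets of elements of this type. It contains the scalars
  and an arbitrary type \<open>'a\<close> of atoms and is closed under pairing. Hence it contains a copy of
  every finite-dimensional vector space, every space with carrier in \<open>'a\<close> (up to renaming by
  \<open>Atom\<close>), and the external direct sum of any two of its spaces.\<close>

datatype ('k, 'a) elt =
    Scalar 'k
  | Atom 'a
  | Pair (pfst: "('k, 'a) elt") (psnd: "('k, 'a) elt")

type_synonym ('k, 'a) space = "('k, ('k, 'a) elt) module"

text \<open>The ground field is the field type \<open>'k\<close>, seen as the structure \<^const>\<open>class_ring\<close>.\<close>

definition fd_space :: "('k :: field, 'a) space \<Rightarrow> bool" where
  "fd_space V \<longleftrightarrow> vectorspace class_ring V \<and> vectorspace.fin_dim class_ring V"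

text \<open>This is \<^const>\<open>direct_sum\<close> with \<^const>\<open>Pair\<close> in place of the ordered pair. The ring
  components \<open>mult\<close> and \<open>one\<close> of the record play no role in a vector space.\<close>

definition ext_sum :: "('k, 'a) space \<Rightarrow> ('k, 'a) space \<Rightarrow> ('k, 'a) space" where
  "ext_sum V W =
     \<lparr>carrier = {Pair v w | v w. v \<in> carrier V \<and> w \<in> carrier W},
      mult = (\<lambda>x y. Pair \<zero>\<^bsub>V\<^esub> \<zero>\<^bsub>W\<^esub>),
      one = Pair \<zero>\<^bsub>V\<^esub> \<zero>\<^bsub>W\<^esub>,
      zero = Pair \<zero>\<^bsub>V\<^esub> \<zero>\<^bsub>W\<^esub>,
      add = (\<lambda>x y. Pair (pfst x \<oplus>\<^bsub>V\<^esub> pfst y) (psnd x \<oplus>\<^bsub>W\<^esub> psnd y)),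
      smult = (\<lambda>c x. Pair (c \<odot>\<^bsub>V\<^esub> pfst x) (c \<odot>\<^bsub>W\<^esub> psnd x))\<rparr>"


section \<open>Quiver representations\<close>

record ('v, 'e, 'k, 'a) rep =
  sp :: "'v \<Rightarrow> ('k, 'a) space"
  mp :: "'e \<Rightarrow> ('k, 'a) elt \<Rightarrow> ('k, 'a) elt"

type_synonym ('v, 'k, 'a) rep_mor = "'v \<Rightarrow> ('k, 'a) elt \<Rightarrow> ('k, 'a) elt"

text \<open>All functions are extensional, so that equality of representations and of morphisms
  is not affected by values outside the relevant domains.\<close>

definition is_representation ::
  "('v, 'e) pre_digraph \<Rightarrow> ('v, 'e, 'k :: field, 'a) rep \<Rightarrow> bool" where
  "is_representation Q X \<longleftrightarrow>
     sp X \<in> extensional (verts Q) \<and> mp X \<in> extensional (arcs Q) \<and>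
     (\<forall>v \<in> verts Q. fd_space (sp X v)) \<and>
     (\<forall>e \<in> arcs Q.
        linear_map class_ring (sp X (tail Q e)) (sp X (head Q e)) (mp X e) \<and>
        mp X e \<in> extensional (carrier (sp X (tail Q e))))"

definition rep_hom ::
  "('v, 'e) pre_digraph \<Rightarrow> ('v, 'e, 'k :: field, 'a) rep \<Rightarrow> ('v, 'e, 'k, 'a) rep \<Rightarrow>
   ('v, 'k, 'a) rep_mor set" where
  "rep_hom Q X Y = {f \<in> extensional (verts Q).
     (\<forall>v \<in> verts Q. linear_map class_ring (sp X v) (sp Y v) (f v) \<and>
        f v \<in> extensional (carrier (sp X v))) \<and>
     (\<forall>e \<in> arcs Q. \<forall>x \<in> carrier (sp X (tail Q e)).
        f (head Q e) (mp X e x) = mp Y e (f (tail Q e) x))}"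

definition rep_category ::
  "('v, 'e) pre_digraph \<Rightarrow> (('v, 'e, 'k :: field, 'a) rep, ('v, 'k, 'a) rep_mor) category" where
  "rep_category Q =
     \<lparr>Obj = {X. is_representation Q X},
      Hom = rep_hom Q,
      Ident = (\<lambda>X. \<lambda>v \<in> verts Q. \<lambda>x \<in> carrier (sp X v). x),
      Comp = (\<lambda>X Y Z g f. \<lambda>v \<in> verts Q. compose (carrier (sp X v)) (g v) (f v))\<rparr>"


section \<open>The three-armed quiver and the joint and double flag categories\<close>

datatype star_vertex = Delta | Alpha nat | Beta nat | Gamma nat

definition arm_arcs :: "(nat \<Rightarrow> star_vertex) \<Rightarrow> nat \<Rightarrow> (star_vertex \<times> star_vertex) set" where
  "arm_arcs A n = {(A i, A (i + 1)) | i. 1 \<le> i \<and> i + 1 \<le> n - 1} \<union>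
     (if n = 1 then {} else {(A (n - 1), Delta)})"

definition star_quiver ::
  "nat \<Rightarrow> nat \<Rightarrow> nat \<Rightarrow> (star_vertex, star_vertex \<times> star_vertex) pre_digraph" where
  "star_quiver r p q =
     \<lparr>verts = {Delta} \<union> Alpha ` {1..r - 1} \<union> Beta ` {1..p - 1} \<union> Gamma ` {1..q - 1},
      arcs = arm_arcs Alpha r \<union> arm_arcs Beta p \<union> arm_arcs Gamma q,
      tail = fst, head = snd\<rparr>"

type_synonym ('k, 'a) star_rep = "(star_vertex, star_vertex \<times> star_vertex, 'k, 'a) rep"
type_synonym ('k, 'a) star_cat = "(('k, 'a) star_rep, (star_vertex, 'k, 'a) rep_mor) category"

text \<open>The image in the space at \<^const>\<open>Delta\<close> of the last space of an arm of length \<open>n - 1\<close>.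
  For \<open>n = 1\<close> the arm is empty and this is the image of the zero space.\<close>

definition arm_image ::
  "('k, 'a) star_rep \<Rightarrow> (nat \<Rightarrow> star_vertex) \<Rightarrow> nat \<Rightarrow> ('k, 'a) elt set" where
  "arm_image X A n =
     (if n = 1 then {\<zero>\<^bsub>sp X Delta\<^esub>}
      else mp X (A (n - 1), Delta) ` carrier (sp X (A (n - 1))))"

definition internal_direct_sum ::
  "('k, 'a) space \<Rightarrow> ('k, 'a) elt set \<Rightarrow> ('k, 'a) elt set \<Rightarrow> bool" where
  "internal_direct_sum V M N \<longleftrightarrow> module.submodule_sum V M N = carrier V \<and> M \<inter> N = {\<zero>\<^bsub>V\<^esub>}"

definition joint_flag :: "nat \<Rightarrow> nat \<Rightarrow> nat \<Rightarrow> ('k, 'a) star_rep \<Rightarrow> bool" where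
  "joint_flag r p q X \<longleftrightarrow>
     (\<forall>e \<in> arcs (star_quiver r p q). inj_on (mp X e) (carrier (sp X (fst e)))) \<and>
     internal_direct_sum (sp X Delta) (arm_image X Beta p) (arm_image X Gamma q)"

text \<open>If \<open>sp X s\<close> is contained in \<open>sp X t\<close> and the (linear) map on the arrow \<open>(s, t)\<close> is the
  inclusion, then \<open>sp X s\<close> is a subspace of \<open>sp X t\<close> with the induced operations.\<close>

definition inclusion_arc :: "('k, 'a) star_rep \<Rightarrow> star_vertex \<times> star_vertex \<Rightarrow> bool" where
  "inclusion_arc X e \<longleftrightarrow>
     carrier (sp X (fst e)) \<subseteq> carrier (sp X (snd e)) \<and>
     mp X e = (\<lambda>x \<in> carrier (sp X (fst e)). x)"

text \<open>\<open>V2\<close> and \<open>V3\<close> are the last spaces of the second and third arm. For an empty arm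
  this is a zero space.\<close>

definition double_flag :: "nat \<Rightarrow> nat \<Rightarrow> nat \<Rightarrow> ('k :: field, 'a) star_rep \<Rightarrow> bool" where
  "double_flag r p q X \<longleftrightarrow>
     (\<exists>V2 V3. fd_space V2 \<and> fd_space V3 \<and> sp X Delta = ext_sum V2 V3 \<and>
        (if p = 1 then carrier V2 = {\<zero>\<^bsub>V2\<^esub>}
         else sp X (Beta (p - 1)) = V2 \<and>
           mp X (Beta (p - 1), Delta) = (\<lambda>x \<in> carrier V2. Pair x \<zero>\<^bsub>V3\<^esub>)) \<and>
        (if q = 1 then carrier V3 = {\<zero>\<^bsub>V3\<^esub>}
         else sp X (Gamma (q - 1)) = V3 \<and>
           mp X (Gamma (q - 1), Delta) = (\<lambda>x \<in> carrier V3. Pair \<zero>\<^bsub>V2\<^esub> x))) \<and>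
     (\<forall>e \<in> arcs (star_quiver r p q) - {(Beta (p - 1), Delta), (Gamma (q - 1), Delta)}.
        inclusion_arc X e)"

definition joint_flag_category :: "nat \<Rightarrow> nat \<Rightarrow> nat \<Rightarrow> ('k :: field, 'a) star_cat" where
  "joint_flag_category r p q =
     full_subcategory (rep_category (star_quiver r p q)) (joint_flag r p q)"

definition double_flag_category :: "nat \<Rightarrow> nat \<Rightarrow> nat \<Rightarrow> ('k :: field, 'a) star_cat" where
  "double_flag_category r p q =
     full_subcategory (joint_flag_category r p q) (double_flag r p q)"

end

theory Submission
  imports Defs
begin

text \<open>
  The double flag category is a full subcategory of the joint flag category, so the inclusion
  functor is fully faithful and only essential surjectivity is at stake: every joint flag
  \<open>X\<close> has to be isomorphic to a double flag (\<open>full_subcategory_equivalent\<close>,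
  \<open>joint_flag_isomorphic_double_flag\<close>).

  Let \<open>V\<close> and \<open>W\<close> be the last spaces of the second and third arm of \<open>X\<close>, and \<open>U\<close> the space at
  the centre. Since the images of \<open>V\<close> and \<open>W\<close> decompose \<open>U\<close>, there is an isomorphism
  \<open>\<psi> : U \<rightarrow> V \<oplus> W\<close> to the external sum which turns the two embeddings into the canonical injections
  (\<open>internal_direct_sum_isomorphism\<close>). All maps of \<open>X\<close> being injective, every space of the first arm
  embeds into \<open>V \<oplus> W\<close> by following the arrows to the centre and applying \<open>\<psi>\<close>, and every space of the
  other two arms embeds into \<open>V\<close> or \<open>W\<close> by following the arrows to the end of its arm. Replace
  every space by its image under this embedding and carry the maps along (\<open>transport_isomorphic\<close>).
  An embedding that follows an arrow first agrees with the embedding at the target of that arrow,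
  so the arrow becomes an inclusion; the two arrows from the ends of the second and third arm to the
  centre become the canonical injections. This is a double flag isomorphic to \<open>X\<close>.

  An empty second or third arm is treated like the others, with the zero subspace of \<open>U\<close> as its
  last space.
\<close>


section \<open>Full subcategories and equivalence\<close>

lemma full_subcategory_simps [simp]:
  "Obj (full_subcategory C P) = {X \<in> Obj C. P X}"
  "Hom (full_subcategory C P) = Hom C"
  "Ident (full_subcategory C P) = Ident C"
  "Comp (full_subcategory C P) = Comp C"
  by (simp_all add: full_subcategory_def)

lemma category_full_subcategory: "category C \<Longrightarrow> category (full_subcategory C P)"
  by (auto simp: category_def)

lemma isomorphism_in_full_subcategory [simp]:
  "isomorphism_in (full_subcategory C P) = isomorphism_in C"
  by (simp add: isomorphism_in_def fun_eq_iff)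

text \<open>A quasi-inverse of the inclusion: choose an isomorphism \<open>\<phi> X\<close> from each object \<open>X\<close> to an
  object \<open>F X\<close> of the subcategory and let \<open>F\<close> act on morphisms by conjugation with the \<open>\<phi> X\<close>. Then
  \<open>\<phi>\<close> and its pointwise inverse \<open>\<psi>\<close> are the two natural isomorphisms.\<close>

lemma full_subcategory_equivalent:
  assumes "category C"
    and dense: "\<And>X. X \<in> Obj C \<Longrightarrow> \<exists>Y \<in> Obj C. P Y \<and> (\<exists>f. isomorphism_in C X Y f)"
  shows "equivalent_categories C (full_subcategory C P)"
proof -
  interpret category C by fact
  let ?D = "full_subcategory C P"
  have D: "category ?D" by (rule category_full_subcategory) fact
  have "\<forall>X. \<exists>Y f g. X \<in> Obj C \<longrightarrow> Y \<in> Obj C \<and> P Y \<and> f \<in> Hom C X Y \<and> g \<in> Hom C Y X \<and>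
      Comp C X Y X g f = Ident C X \<and> Comp C Y X Y f g = Ident C Y"
    using dense by (fastforce simp: isomorphism_in_def)
  then obtain F \<phi> \<psi> where F': "\<And>X. X \<in> Obj C \<Longrightarrow> F X \<in> Obj C \<and> P (F X) \<and>
      \<phi> X \<in> Hom C X (F X) \<and> \<psi> X \<in> Hom C (F X) X \<and>
      Comp C X (F X) X (\<psi> X) (\<phi> X) = Ident C X \<and> Comp C (F X) X (F X) (\<phi> X) (\<psi> X) = Ident C (F X)"
    by metis
  have F [simp]: "F X \<in> Obj C" "P (F X)" "\<phi> X \<in> Hom C X (F X)" "\<psi> X \<in> Hom C (F X) X"
      "Comp C X (F X) X (\<psi> X) (\<phi> X) = Ident C X" "Comp C (F X) X (F X) (\<phi> X) (\<psi> X) = Ident C (F X)"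
    if "X \<in> Obj C" for X
    using F'[OF that] by auto
  define Fm where "Fm X Y f = Comp C (F X) Y (F Y) (\<phi> Y) (Comp C (F X) X Y f (\<psi> X))" for X Y f
  have Fm_hom [simp]: "Fm X Y f \<in> Hom C (F X) (F Y)"
    if "X \<in> Obj C" "Y \<in> Obj C" "f \<in> Hom C X Y" for X Y f
    unfolding Fm_def by (meson F that comp_in_Hom)
  have nat_\<phi>: "Comp C X (F X) (F Y) (Fm X Y f) (\<phi> X) = Comp C X Y (F Y) (\<phi> Y) f"
    if X: "X \<in> Obj C" "Y \<in> Obj C" and f: "f \<in> Hom C X Y" for X Y f
  proof -
    have "Comp C X (F X) (F Y) (Fm X Y f) (\<phi> X) =
        Comp C X Y (F Y) (\<phi> Y) (Comp C X (F X) Y (Comp C (F X) X Y f (\<psi> X)) (\<phi> X))"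
      unfolding Fm_def using X f by (intro comp_assoc[symmetric]) (auto intro: comp_in_Hom)
    also have "Comp C X (F X) Y (Comp C (F X) X Y f (\<psi> X)) (\<phi> X) =
        Comp C X X Y f (Comp C X (F X) X (\<psi> X) (\<phi> X))"
      using X f by (intro comp_assoc[symmetric]) auto
    finally show ?thesis using X f by (simp add: comp_ident_right)
  qed
  have nat_\<psi>: "Comp C (F X) (F Y) Y (\<psi> Y) (Fm X Y f) = Comp C (F X) X Y f (\<psi> X)"
    if X: "X \<in> Obj C" "Y \<in> Obj C" and f: "f \<in> Hom C X Y" for X Y f
  proof -
    have h: "Comp C (F X) X Y f (\<psi> X) \<in> Hom C (F X) Y"
      using X f by (intro comp_in_Hom) auto
    have "Comp C (F X) (F Y) Y (\<psi> Y) (Fm X Y f) =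
        Comp C (F X) Y Y (Comp C Y (F Y) Y (\<psi> Y) (\<phi> Y)) (Comp C (F X) X Y f (\<psi> X))"
      unfolding Fm_def using X h by (intro comp_assoc) auto
    then show ?thesis using X h by (simp add: comp_ident_left)
  qed
  have iso: "isomorphism_in C X (F X) (\<phi> X)" "isomorphism_in C (F X) X (\<psi> X)"
    if "X \<in> Obj C" for X
    unfolding isomorphism_in_def using F[OF that] by blast+
  have "covariant_functor C ?D F Fm"
  proof (intro covariant_functor.intro covariant_functor_axioms.intro)
    fix X assume "X \<in> Obj C"
    then show "Fm X X (Ident C X) = Ident ?D (F X)"
      by (simp add: Fm_def comp_ident_left ident_in_Hom)
  next
    fix X Y Z f g assume X: "X \<in> Obj C" "Y \<in> Obj C" "Z \<in> Obj C"
      and f: "f \<in> Hom C X Y" and g: "g \<in> Hom C Y Z"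
    have h: "Comp C (F X) X Y f (\<psi> X) \<in> Hom C (F X) Y"
      using X f by (intro comp_in_Hom) auto
    have "Fm X Z (Comp C X Y Z g f) =
        Comp C (F X) Z (F Z) (\<phi> Z) (Comp C (F X) Y Z g (Comp C (F X) X Y f (\<psi> X)))"
      unfolding Fm_def using X f g by (simp add: comp_assoc)
    also have "\<dots> = Comp C (F X) Y (F Z) (Comp C Y Z (F Z) (\<phi> Z) g) (Comp C (F X) X Y f (\<psi> X))"
      using X g h by (intro comp_assoc) auto
    also have "\<dots> = Comp C (F X) Y (F Z) (Comp C Y (F Y) (F Z) (Fm Y Z g) (\<phi> Y))
        (Comp C (F X) X Y f (\<psi> X))"
      using X g by (simp add: nat_\<phi>)
    also have "\<dots> = Comp C (F X) (F Y) (F Z) (Fm Y Z g) (Fm X Y f)"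
      unfolding Fm_def[of X Y f] using X g h by (intro comp_assoc[symmetric]) auto
    finally show "Fm X Z (Comp C X Y Z g f) = Comp ?D (F X) (F Y) (F Z) (Fm Y Z g) (Fm X Y f)"
      by simp
  qed (use D in \<open>auto intro: category_axioms\<close>)
  moreover have "covariant_functor ?D C (\<lambda>X. X) (\<lambda>X Y f. f)"
    using D by (auto intro!: covariant_functor.intro covariant_functor_axioms.intro category_axioms)
  moreover have "natural_isomorphism C C (\<lambda>X. X) (\<lambda>X Y f. f) F Fm \<phi>"
    unfolding natural_isomorphism_def using iso by (auto simp: nat_\<phi>)
  moreover have "natural_isomorphism ?D ?D F Fm (\<lambda>X. X) (\<lambda>X Y f. f) \<psi>"
    unfolding natural_isomorphism_def using iso by (auto simp: nat_\<psi>)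
  ultimately show ?thesis
    unfolding equivalent_categories_def by fast
qed


section \<open>Linear maps\<close>

lemma linear_map_iff:
  "linear_map K V W f \<longleftrightarrow> vectorspace K V \<and> vectorspace K W \<and> f \<in> LinearCombinations.module_hom K V W"
  by (auto simp: linear_map_def mod_hom_def mod_hom_axioms_def vectorspace_def)

lemma linear_map_cong:
  assumes "\<And>x. x \<in> carrier V \<Longrightarrow> f x = g x"
  shows "linear_map K V W f \<longleftrightarrow> linear_map K V W g"
proof -
  have "f \<in> LinearCombinations.module_hom K V W \<longleftrightarrow> g \<in> LinearCombinations.module_hom K V W" if "vectorspace K V"
  proof -
    interpret vectorspace K V by fact
    show ?thesis using assms by (auto simp: LinearCombinations.module_hom_def Pi_iff)
  qed
  then show ?thesis by (auto simp: linear_map_iff)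
qed

lemma linear_map_restrict [simp]:
  "linear_map K V W (restrict f (carrier V)) \<longleftrightarrow> linear_map K V W f"
  by (rule linear_map_cong) simp

lemma linear_map_in: "linear_map K V W f \<Longrightarrow> x \<in> carrier V \<Longrightarrow> f x \<in> carrier W"
  by (auto simp: linear_map_iff LinearCombinations.module_hom_def)

lemma linear_map_ident: "vectorspace K V \<Longrightarrow> linear_map K V V (\<lambda>x. x)"
  by (auto simp: linear_map_iff LinearCombinations.module_hom_def)

lemma linear_map_comp:
  assumes "linear_map K U V f" "linear_map K V W g"
  shows "linear_map K U W (\<lambda>x. g (f x))"
  using assms by (auto simp: linear_map_iff LinearCombinations.module_hom_def Pi_iff)

lemma linear_map_inv_into:
  assumes "linear_map K V W f" and bij: "bij_betw f (carrier V) (carrier W)"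
  shows "linear_map K W V (inv_into (carrier V) f)"
proof -
  interpret linear_map K V W f by fact
  let ?g = "inv_into (carrier V) f"
  have g [simp]: "?g y \<in> carrier V" "f (?g y) = y" if "y \<in> carrier W" for y
    using bij that by (auto simp: bij_betw_def inv_into_into f_inv_into_f)
  have eq: "?g y = x" if "x \<in> carrier V" "f x = y" for x y
    using bij that by (auto simp: bij_betw_def)
  have "?g \<in> LinearCombinations.module_hom K W V"
    by (auto simp: LinearCombinations.module_hom_def intro!: eq)
  then show ?thesis
    by (simp add: linear_map_iff V.vectorspace_axioms W.vectorspace_axioms)
qed

text \<open>The subspace is represented as the ambient record with a smaller carrier, so it inherits the
  operations of \<open>W\<close>. This makes nested images genuine subspaces of each other.\<close>

lemma linear_map_onto_image:
  assumes "linear_map K V W f"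
  shows "linear_map K V (W\<lparr>carrier := f ` carrier V\<rparr>) f"
proof -
  interpret linear_map K V W f by fact
  have "vectorspace K (W\<lparr>carrier := f ` carrier V\<rparr>)"
    using W.subspace_is_vs[OF imT_is_subspace] by (simp add: im_def)
  then show ?thesis
    using f_hom V.vectorspace_axioms by (auto simp: linear_map_iff LinearCombinations.module_hom_def)
qed

lemma fd_space_image:
  assumes "fd_space V" "linear_map class_ring V W f"
  shows "fd_space (W\<lparr>carrier := f ` carrier V\<rparr>)"
proof -
  interpret linear_map class_ring V "W\<lparr>carrier := f ` carrier V\<rparr>" f
    using assms by (intro linear_map_onto_image)
  show ?thesis
    using assms rank_nullity_main(2) W.vectorspace_axioms by (auto simp: fd_space_def)
qed


section \<open>External direct sums\<close>

lemma ext_sum_simps [simp]: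
  "carrier (ext_sum V W) = {Pair v w | v w. v \<in> carrier V \<and> w \<in> carrier W}"
  "\<zero>\<^bsub>ext_sum V W\<^esub> = Pair \<zero>\<^bsub>V\<^esub> \<zero>\<^bsub>W\<^esub>"
  "x \<oplus>\<^bsub>ext_sum V W\<^esub> y = Pair (pfst x \<oplus>\<^bsub>V\<^esub> pfst y) (psnd x \<oplus>\<^bsub>W\<^esub> psnd y)"
  "c \<odot>\<^bsub>ext_sum V W\<^esub> x = Pair (c \<odot>\<^bsub>V\<^esub> pfst x) (c \<odot>\<^bsub>W\<^esub> psnd x)"
  by (simp_all add: ext_sum_def)

lemma vectorspace_ext_sum:
  fixes V W :: "('k :: field, 'a) space"
  assumes "vectorspace class_ring V" "vectorspace class_ring W"
  shows "vectorspace class_ring (ext_sum V W)"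
proof -
  interpret V: vectorspace class_ring V by fact
  interpret W: vectorspace class_ring W by fact
  have neg: "\<exists>w\<in>carrier (ext_sum V W). v \<oplus>\<^bsub>ext_sum V W\<^esub> w = \<zero>\<^bsub>ext_sum V W\<^esub>"
    if "v \<in> carrier (ext_sum V W)" for v
    using that by (intro bexI[of _ "Pair (\<ominus>\<^bsub>V\<^esub> pfst v) (\<ominus>\<^bsub>W\<^esub> psnd v)"])
      (auto simp: V.M.r_neg W.M.r_neg)
  have one: "1 \<odot>\<^bsub>V\<^esub> v = v" "1 \<odot>\<^bsub>W\<^esub> w = w" if "v \<in> carrier V" "w \<in> carrier W" for v w
    using V.smult_one W.smult_one that by auto
  show ?thesis
  proof (rule vs_criteria)
    show "field (class_ring :: 'k ring)" by (rule class_field)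
    show "\<forall>v\<in>carrier (ext_sum V W).
        \<exists>w\<in>carrier (ext_sum V W). v \<oplus>\<^bsub>ext_sum V W\<^esub> w = \<zero>\<^bsub>ext_sum V W\<^esub>"
      using neg by blast
  qed (use V.smult_assoc1 W.smult_assoc1 V.smult_l_distr W.smult_l_distr in
    \<open>auto simp: V.M.a_ac W.M.a_ac V.smult_r_distr W.smult_r_distr one\<close>)
qed

text \<open>The sum of submodules is a constant of the locale of modules; its defining equation is
  available only for an actual module.\<close>

lemma internal_direct_sum_iff:
  fixes V :: "('k, 'a) space"
  assumes "vectorspace K V"
  shows "internal_direct_sum V M N \<longleftrightarrow>
     {x \<oplus>\<^bsub>V\<^esub> y | x y. x \<in> M \<and> y \<in> N} = carrier V \<and> M \<inter> N = {\<zero>\<^bsub>V\<^esub>}"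
proof -
  interpret vectorspace K V by fact
  have "submodule_sum M N = {x \<oplus>\<^bsub>V\<^esub> y | x y. x \<in> M \<and> y \<in> N}"
    by (auto simp: submodule_sum_def)
  then show ?thesis by (simp add: internal_direct_sum_def)
qed

lemma internal_direct_sum_ext_sum:
  fixes V W :: "('k :: field, 'a) space"
  assumes "vectorspace class_ring V" "vectorspace class_ring W"
  shows "internal_direct_sum (ext_sum V W)
     ((\<lambda>x. Pair x \<zero>\<^bsub>W\<^esub>) ` carrier V) ((\<lambda>x. Pair \<zero>\<^bsub>V\<^esub> x) ` carrier W)"
proof -
  interpret V: vectorspace class_ring V by fact
  interpret W: vectorspace class_ring W by fact
  have add: "Pair v \<zero>\<^bsub>W\<^esub> \<oplus>\<^bsub>ext_sum V W\<^esub> Pair \<zero>\<^bsub>V\<^esub> w = Pair v w"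
    if "v \<in> carrier V" "w \<in> carrier W" for v w
    using that by simp
  have "{x \<oplus>\<^bsub>ext_sum V W\<^esub> y | x y.
      x \<in> (\<lambda>x. Pair x \<zero>\<^bsub>W\<^esub>) ` carrier V \<and> y \<in> (\<lambda>x. Pair \<zero>\<^bsub>V\<^esub> x) ` carrier W} =
      {Pair v \<zero>\<^bsub>W\<^esub> \<oplus>\<^bsub>ext_sum V W\<^esub> Pair \<zero>\<^bsub>V\<^esub> w | v w. v \<in> carrier V \<and> w \<in> carrier W}"
    by blast
  also have "\<dots> = {Pair v w | v w. v \<in> carrier V \<and> w \<in> carrier W}"
    by (intro Collect_cong ex_cong1) (metis add)
  finally have "{x \<oplus>\<^bsub>ext_sum V W\<^esub> y | x y.
      x \<in> (\<lambda>x. Pair x \<zero>\<^bsub>W\<^esub>) ` carrier V \<and> y \<in> (\<lambda>x. Pair \<zero>\<^bsub>V\<^esub> x) ` carrier W} =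
      carrier (ext_sum V W)"
    by (simp only: ext_sum_simps(1))
  moreover have "(\<lambda>x. Pair x \<zero>\<^bsub>W\<^esub>) ` carrier V \<inter> (\<lambda>x. Pair \<zero>\<^bsub>V\<^esub> x) ` carrier W = {\<zero>\<^bsub>ext_sum V W\<^esub>}"
    by auto
  ultimately show ?thesis
    by (simp only: internal_direct_sum_iff[OF vectorspace_ext_sum[OF assms]] simp_thms)
qed

lemma (in abelian_group) minus_eq_minus_of_add_eq:
  assumes "a \<in> carrier G" "b \<in> carrier G" "c \<in> carrier G" "d \<in> carrier G"
    and eq: "a \<oplus> b = c \<oplus> d"
  shows "a \<ominus> c = d \<ominus> b"
proof -
  have "a \<ominus> c = (a \<oplus> b) \<oplus> (\<ominus> b \<oplus> \<ominus> c)"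
    using assms(1-4) by (simp add: a_minus_def a_assoc r_neg2)
  also have "\<dots> = (d \<oplus> c) \<oplus> (\<ominus> c \<oplus> \<ominus> b)"
    unfolding eq using assms(1-4) by (simp add: a_comm)
  also have "\<dots> = d \<ominus> b"
    using assms(1-4) by (simp add: a_minus_def a_assoc r_neg2)
  finally show ?thesis .
qed

text \<open>The map sending a pair \<open>(a, b)\<close> to \<open>f a + g b\<close> is onto because the images of \<open>f\<close> and \<open>g\<close> span,
  and it is injective because these images meet only in zero; its inverse is the required \<open>\<psi>\<close>.\<close>

lemma internal_direct_sum_isomorphism:
  fixes U V W :: "('k :: field, 'a) space"
  assumes f: "linear_map class_ring V U f" "inj_on f (carrier V)"
    and g: "linear_map class_ring W U g" "inj_on g (carrier W)"
    and sum: "internal_direct_sum U (f ` carrier V) (g ` carrier W)"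
  obtains \<psi> where "linear_map class_ring U (ext_sum V W) \<psi>"
    "bij_betw \<psi> (carrier U) (carrier (ext_sum V W))"
    "\<And>x. x \<in> carrier V \<Longrightarrow> \<psi> (f x) = Pair x \<zero>\<^bsub>W\<^esub>"
    "\<And>x. x \<in> carrier W \<Longrightarrow> \<psi> (g x) = Pair \<zero>\<^bsub>V\<^esub> x"
proof -
  interpret U: vectorspace class_ring U using f by (simp add: linear_map_iff)
  interpret V: vectorspace class_ring V using f by (simp add: linear_map_iff)
  interpret W: vectorspace class_ring W using g by (simp add: linear_map_iff)
  interpret f: linear_map class_ring V U f by fact
  interpret g: linear_map class_ring W U g by fact
  define \<phi> where "\<phi> x = f (pfst x) \<oplus>\<^bsub>U\<^esub> g (psnd x)" for x
  have "\<phi> \<in> LinearCombinations.module_hom class_ring (ext_sum V W) U"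
    using f.T_smult g.T_smult U.smult_r_distr
    by (auto simp: LinearCombinations.module_hom_def \<phi>_def U.M.a_ac)
  then have lin: "linear_map class_ring (ext_sum V W) U \<phi>"
    by (simp add: linear_map_iff vectorspace_ext_sum V.vectorspace_axioms W.vectorspace_axioms
        U.vectorspace_axioms)
  interpret \<phi>: linear_map class_ring "ext_sum V W" U \<phi> by fact
  have sum': "{x \<oplus>\<^bsub>U\<^esub> y | x y. x \<in> f ` carrier V \<and> y \<in> g ` carrier W} = carrier U"
      "f ` carrier V \<inter> g ` carrier W = {\<zero>\<^bsub>U\<^esub>}"
    using sum by (simp_all add: internal_direct_sum_iff[OF U.vectorspace_axioms])
  have "inj_on \<phi> (carrier (ext_sum V W))"
  proof (rule inj_onI)
    fix x y assume "x \<in> carrier (ext_sum V W)" "y \<in> carrier (ext_sum V W)" and eq: "\<phi> x = \<phi> y"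
    then obtain a b c d where x: "x = Pair a b" "a \<in> carrier V" "b \<in> carrier W"
      and y: "y = Pair c d" "c \<in> carrier V" "d \<in> carrier W" by auto
    from eq x y have e: "f a \<oplus>\<^bsub>U\<^esub> g b = f c \<oplus>\<^bsub>U\<^esub> g d" by (simp add: \<phi>_def)
    \<comment> \<open>This difference lies in both images, hence vanishes.\<close>
    have "f a \<ominus>\<^bsub>U\<^esub> f c = g d \<ominus>\<^bsub>U\<^esub> g b"
      using e x y by (intro U.M.minus_eq_minus_of_add_eq) auto
    then have "f (a \<ominus>\<^bsub>V\<^esub> c) = g (d \<ominus>\<^bsub>W\<^esub> b)" using x y by simp
    moreover have "a \<ominus>\<^bsub>V\<^esub> c \<in> carrier V" "d \<ominus>\<^bsub>W\<^esub> b \<in> carrier W" using x y by simp_all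
    ultimately have "f (a \<ominus>\<^bsub>V\<^esub> c) = \<zero>\<^bsub>U\<^esub>" "g (d \<ominus>\<^bsub>W\<^esub> b) = \<zero>\<^bsub>U\<^esub>"
      using sum'(2) by (metis IntI imageI singletonD)+
    then have "f a = f c" "g d = g b" using x y by simp_all
    then show "x = y" using x y f(2) g(2) by (auto dest: inj_onD)
  qed
  moreover have "\<phi> ` carrier (ext_sum V W) = carrier U"
    unfolding sum'(1)[symmetric] by (force simp: \<phi>_def image_iff)
  ultimately have bij: "bij_betw \<phi> (carrier (ext_sum V W)) (carrier U)" by (simp add: bij_betw_def)
  let ?\<psi> = "inv_into (carrier (ext_sum V W)) \<phi>"
  have eq: "?\<psi> y = x" if "x \<in> carrier (ext_sum V W)" "\<phi> x = y" for x y
    using bij that by (auto simp: bij_betw_def simp del: ext_sum_simps)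
  show thesis
  proof (rule that)
    show "linear_map class_ring U (ext_sum V W) ?\<psi>" by (rule linear_map_inv_into[OF lin bij])
    show "bij_betw ?\<psi> (carrier U) (carrier (ext_sum V W))" by (rule bij_betw_inv_into[OF bij])
  qed (rule eq; force simp: \<phi>_def)+
qed


section \<open>Categories of representations\<close>

lemma rep_category_simps [simp]:
  "Obj (rep_category Q) = {X. is_representation Q X}"
  "Hom (rep_category Q) = rep_hom Q"
  "Ident (rep_category Q) X = (\<lambda>v \<in> verts Q. \<lambda>x \<in> carrier (sp X v). x)"
  "Comp (rep_category Q) X Y Z g f = (\<lambda>v \<in> verts Q. compose (carrier (sp X v)) (g v) (f v))"
  by (simp_all add: rep_category_def)

lemma rep_hom_in:
  "f \<in> rep_hom Q X Y \<Longrightarrow> v \<in> verts Q \<Longrightarrow> x \<in> carrier (sp X v) \<Longrightarrow> f v x \<in> carrier (sp Y v)"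
  by (auto simp: rep_hom_def intro: linear_map_in)

lemma representation_map_in:
  "is_representation Q X \<Longrightarrow> e \<in> arcs Q \<Longrightarrow> x \<in> carrier (sp X (tail Q e)) \<Longrightarrow>
    mp X e x \<in> carrier (sp X (head Q e))"
  by (auto simp: is_representation_def intro: linear_map_in)

lemma representation_vectorspace:
  "is_representation Q X \<Longrightarrow> v \<in> verts Q \<Longrightarrow> vectorspace class_ring (sp X v)"
  by (auto simp: is_representation_def fd_space_def)

text \<open>Components of morphisms are extensional, so it suffices to compare them on the spaces of \<open>X\<close>.\<close>

lemma rep_hom_eqI:
  assumes "f \<in> rep_hom Q X Y" "g \<in> rep_hom Q X Z"
    and "\<And>v x. v \<in> verts Q \<Longrightarrow> x \<in> carrier (sp X v) \<Longrightarrow> f v x = g v x"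
  shows "f = g"
proof (rule extensionalityI)
  show "f v = g v" if "v \<in> verts Q" for v
    using assms that by (intro extensionalityI[of _ "carrier (sp X v)"]) (auto simp: rep_hom_def)
qed (use assms in \<open>auto simp: rep_hom_def\<close>)

lemma category_rep_category:
  assumes "wf_digraph Q"
  shows "category (rep_category Q)"
proof -
  interpret wf_digraph Q by fact
  have ident: "Ident (rep_category Q) X \<in> rep_hom Q X X" if "is_representation Q X" for X
    using that representation_map_in[OF that] representation_vectorspace[OF that]
    by (auto simp: rep_hom_def intro!: linear_map_ident)
  have comp: "Comp (rep_category Q) X Y Z g f \<in> rep_hom Q X Z"
    if "is_representation Q X" and f: "f \<in> rep_hom Q X Y" and g: "g \<in> rep_hom Q Y Z" for X Y Z f g
  proof -
    have "linear_map class_ring (sp X v) (sp Z v) (compose (carrier (sp X v)) (g v) (f v))"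
      if "v \<in> verts Q" for v
      using f g that linear_map_comp[of class_ring "sp X v" "sp Y v" "f v" "sp Z v" "g v"]
      by (simp add: rep_hom_def compose_def)
    then show ?thesis
      using f g that(1) rep_hom_in[OF f] representation_map_in[OF that(1)]
      by (auto simp: rep_hom_def compose_def)
  qed
  show ?thesis
  proof
    fix X assume "X \<in> Obj (rep_category Q)"
    then show "Ident (rep_category Q) X \<in> Hom (rep_category Q) X X"
      using ident by simp
  next
    fix X Y Z f g
    assume "X \<in> Obj (rep_category Q)" "f \<in> Hom (rep_category Q) X Y" "g \<in> Hom (rep_category Q) Y Z"
    then show "Comp (rep_category Q) X Y Z g f \<in> Hom (rep_category Q) X Z"
      using comp[of X f Y g Z] by simp
  next
    fix X Y f assume X: "X \<in> Obj (rep_category Q)" "Y \<in> Obj (rep_category Q)"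
      and f: "f \<in> Hom (rep_category Q) X Y"
    show "Comp (rep_category Q) X X Y f (Ident (rep_category Q) X) = f"
      by (rule rep_hom_eqI[OF comp[of X _ X]]) (use X f ident in \<open>auto simp: compose_def\<close>)
    show "Comp (rep_category Q) X Y Y (Ident (rep_category Q) Y) f = f"
      by (rule rep_hom_eqI[OF comp[of X _ Y]])
        (use X f ident in \<open>auto simp: compose_def dest: rep_hom_in\<close>)
  next
    fix W X Y Z f g h
    assume obj: "W \<in> Obj (rep_category Q)" "X \<in> Obj (rep_category Q)"
        "Y \<in> Obj (rep_category Q)" "Z \<in> Obj (rep_category Q)"
      and hom: "f \<in> Hom (rep_category Q) W X" "g \<in> Hom (rep_category Q) X Y"
        "h \<in> Hom (rep_category Q) Y Z"
    then show "Comp (rep_category Q) W Y Z h (Comp (rep_category Q) W X Y g f) =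
        Comp (rep_category Q) W X Z (Comp (rep_category Q) X Y Z h g) f"
      by (auto simp: fun_eq_iff compose_def restrict_def dest: rep_hom_in)
  qed
qed

text \<open>The pointwise inverse of a morphism commutes with the arrows because the morphism does.\<close>

lemma isomorphism_in_rep_category:
  assumes "wf_digraph Q" "is_representation Q X" "is_representation Q Y"
    and f: "f \<in> rep_hom Q X Y"
    and bij: "\<And>v. v \<in> verts Q \<Longrightarrow> bij_betw (f v) (carrier (sp X v)) (carrier (sp Y v))"
  shows "isomorphism_in (rep_category Q) X Y f"
proof -
  interpret wf_digraph Q by fact
  define g where "g = (\<lambda>v \<in> verts Q. \<lambda>y \<in> carrier (sp Y v). inv_into (carrier (sp X v)) (f v) y)"
  have gf: "g v (f v x) = x" if "v \<in> verts Q" "x \<in> carrier (sp X v)" for v x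
    using bij[OF that(1)] that rep_hom_in[OF f] by (auto simp: g_def bij_betw_def)
  have fg: "f v (g v y) = y" "g v y \<in> carrier (sp X v)" if "v \<in> verts Q" "y \<in> carrier (sp Y v)" for v y
    using bij[OF that(1)] that by (auto simp: g_def bij_betw_def f_inv_into_f inv_into_into)
  have lin: "linear_map class_ring (sp Y v) (sp X v) (g v)" if "v \<in> verts Q" for v
    using linear_map_inv_into[OF _ bij[OF that]] f that by (auto simp: g_def rep_hom_def)
  have "g (head Q e) (mp Y e y) = mp X e (g (tail Q e) y)"
    if e: "e \<in> arcs Q" and y: "y \<in> carrier (sp Y (tail Q e))" for e y
  proof -
    let ?x = "g (tail Q e) y"
    have x: "?x \<in> carrier (sp X (tail Q e))" "y = f (tail Q e) ?x" using e y fg by simp_all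
    then have "mp Y e y = f (head Q e) (mp X e ?x)"
      using f e by (auto simp: rep_hom_def)
    then show ?thesis
      using e x(1) representation_map_in[OF assms(2)] by (simp add: gf)
  qed
  then have "g \<in> rep_hom Q Y X"
    using lin by (auto simp: rep_hom_def) (auto simp: g_def)
  then show ?thesis
    unfolding isomorphism_in_def using f
    by (auto simp: compose_def gf fg intro!: bexI[of _ g] restrict_ext)
qed

text \<open>Transport of structure: \<open>X\<close> is moved along embeddings \<open>T v\<close> of its spaces into given spaces
  \<open>E v\<close>. The new spaces are the images of \<open>T v\<close>, with the operations of \<open>E v\<close>, and the new maps are
  the conjugates of the old ones, so that \<open>T\<close> becomes an isomorphism of representations.\<close>

definition transport ::
  "('v, 'e) pre_digraph \<Rightarrow> ('v, 'e, 'k :: field, 'a) rep \<Rightarrow> ('v \<Rightarrow> ('k, 'a) space) \<Rightarrow>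
   ('v \<Rightarrow> ('k, 'a) elt \<Rightarrow> ('k, 'a) elt) \<Rightarrow> ('v, 'e, 'k, 'a) rep" where
  "transport Q X E T =
     \<lparr>sp = (\<lambda>v \<in> verts Q. (E v)\<lparr>carrier := T v ` carrier (sp X v)\<rparr>),
      mp = (\<lambda>e \<in> arcs Q. \<lambda>y \<in> T (tail Q e) ` carrier (sp X (tail Q e)).
        T (head Q e) (mp X e (inv_into (carrier (sp X (tail Q e))) (T (tail Q e)) y)))\<rparr>"

lemma sp_transport [simp]:
  "v \<in> verts Q \<Longrightarrow> sp (transport Q X E T) v = (E v)\<lparr>carrier := T v ` carrier (sp X v)\<rparr>"
  by (simp add: transport_def)

lemma mp_transport:
  assumes "e \<in> arcs Q" "inj_on (T (tail Q e)) (carrier (sp X (tail Q e)))" "x \<in> carrier (sp X (tail Q e))"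
  shows "mp (transport Q X E T) e (T (tail Q e) x) = T (head Q e) (mp X e x)"
  using assms by (simp add: transport_def)

lemma mp_transport_extensional:
  "e \<in> arcs Q \<Longrightarrow> mp (transport Q X E T) e \<in> extensional (T (tail Q e) ` carrier (sp X (tail Q e)))"
  by (simp add: transport_def)

lemma mp_transport_fixed_tail:
  assumes "e \<in> arcs Q" "T (tail Q e) = (\<lambda>x. x)"
  shows "mp (transport Q X E T) e = (\<lambda>x \<in> carrier (sp X (tail Q e)). T (head Q e) (mp X e x))"
proof (rule extensionalityI)
  show "mp (transport Q X E T) e \<in> extensional (carrier (sp X (tail Q e)))"
    using mp_transport_extensional[OF assms(1), of X E T] assms(2) by simp
  fix x assume "x \<in> carrier (sp X (tail Q e))"
  then show "mp (transport Q X E T) e x = (\<lambda>x \<in> carrier (sp X (tail Q e)). T (head Q e) (mp X e x)) x"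
    using mp_transport[OF assms(1), of T X x E] by (simp add: assms(2))
qed simp

lemma transport_isomorphic:
  assumes "wf_digraph Q" and X: "is_representation Q X"
    and lin: "\<And>v. v \<in> verts Q \<Longrightarrow> linear_map class_ring (sp X v) (E v) (T v)"
    and inj: "\<And>v. v \<in> verts Q \<Longrightarrow> inj_on (T v) (carrier (sp X v))"
  shows "is_representation Q (transport Q X E T)"
    and "isomorphism_in (rep_category Q) X (transport Q X E T)
      (\<lambda>v \<in> verts Q. restrict (T v) (carrier (sp X v)))"
proof -
  interpret wf_digraph Q by fact
  let ?Y = "transport Q X E T"
  have lin': "linear_map class_ring (sp X v) (sp ?Y v) (T v)" if "v \<in> verts Q" for v
    using linear_map_onto_image[OF lin[OF that]] that by simp
  have bij: "bij_betw (T v) (carrier (sp X v)) (carrier (sp ?Y v))" if "v \<in> verts Q" for v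
    using inj that by (simp add: bij_betw_def)
  have "linear_map class_ring (sp ?Y (tail Q e)) (sp ?Y (head Q e)) (mp ?Y e)" if e: "e \<in> arcs Q" for e
  proof -
    have "linear_map class_ring (sp ?Y (tail Q e)) (sp ?Y (head Q e))
        (\<lambda>y. T (head Q e) (mp X e (inv_into (carrier (sp X (tail Q e))) (T (tail Q e)) y)))"
      using e X lin'
      by (intro linear_map_comp[OF linear_map_inv_into[OF lin' bij]] linear_map_comp[OF _ lin'])
        (auto simp: is_representation_def)
    then show ?thesis
      using e by (subst (asm) linear_map_restrict[symmetric]) (simp add: transport_def)
  qed
  moreover have "fd_space (sp ?Y v)" if "v \<in> verts Q" for v
    using X fd_space_image[OF _ lin[OF that]] that by (simp add: is_representation_def)
  ultimately show Y: "is_representation Q ?Y"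
    using mp_transport_extensional[of _ Q X E T]
    by (auto simp: is_representation_def) (auto simp: transport_def)
  show "isomorphism_in (rep_category Q) X ?Y (\<lambda>v \<in> verts Q. restrict (T v) (carrier (sp X v)))"
  proof (rule isomorphism_in_rep_category[OF \<open>wf_digraph Q\<close> X Y])
    show "(\<lambda>v \<in> verts Q. restrict (T v) (carrier (sp X v))) \<in> rep_hom Q X ?Y"
      using lin' inj representation_map_in[OF X] by (auto simp: rep_hom_def mp_transport)
  qed (use bij in \<open>simp add: bij_betw_restrict_eq\<close>)
qed


section \<open>The three-armed quiver\<close>

lemma star_quiver_simps [simp]:
  "tail (star_quiver r p q) = fst" "head (star_quiver r p q) = snd"
  "Delta \<in> verts (star_quiver r p q)"
  "Alpha i \<in> verts (star_quiver r p q) \<longleftrightarrow> 1 \<le> i \<and> i < r"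
  "Beta i \<in> verts (star_quiver r p q) \<longleftrightarrow> 1 \<le> i \<and> i < p"
  "Gamma i \<in> verts (star_quiver r p q) \<longleftrightarrow> 1 \<le> i \<and> i < q"
  by (auto simp: star_quiver_def)

lemma arcs_star_quiver:
  "arcs (star_quiver r p q) = arm_arcs Alpha r \<union> arm_arcs Beta p \<union> arm_arcs Gamma q"
  by (simp add: star_quiver_def)

lemma arm_arcs_iff:
  assumes "n \<ge> 1"
  shows "e \<in> arm_arcs A n \<longleftrightarrow>
    (\<exists>i. 1 \<le> i \<and> Suc i < n \<and> e = (A i, A (Suc i))) \<or> n > 1 \<and> e = (A (n - 1), Delta)"
  using assms by (auto simp: arm_arcs_def)

lemma arm_arcs_stepI:
  assumes "1 \<le> i" "Suc i < n"
  shows "(A i, A (Suc i)) \<in> arm_arcs A n"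
proof -
  have "(A i, A (i + 1)) \<in> {(A i, A (i + 1)) | i. 1 \<le> i \<and> i + 1 \<le> n - 1}"
    using assms by (intro CollectI exI[of _ i]) simp
  then show ?thesis unfolding arm_arcs_def by simp
qed

lemma wf_star_quiver:
  assumes "r \<ge> 1" "p \<ge> 1" "q \<ge> 1"
  shows "wf_digraph (star_quiver r p q)"
  by unfold_locales (use assms in \<open>auto simp: arcs_star_quiver arm_arcs_iff\<close>)

text \<open>\<open>arm_path X A k i\<close> is the composite of the maps along the \<open>k\<close> arrows that lead from \<open>A i\<close> to
  \<open>A (i + k)\<close>.\<close>

primrec arm_path ::
  "('k, 'a) star_rep \<Rightarrow> (nat \<Rightarrow> star_vertex) \<Rightarrow> nat \<Rightarrow> nat \<Rightarrow> ('k, 'a) elt \<Rightarrow> ('k, 'a) elt" where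
  "arm_path X A 0 i x = x"
| "arm_path X A (Suc k) i x = arm_path X A k (Suc i) (mp X (A i, A (Suc i)) x)"

text \<open>The path from \<open>A i\<close> to the end \<open>A (n - 1)\<close> of the arm has \<open>n - Suc i\<close> arrows.\<close>

lemma arm_path_step:
  "Suc i < n \<Longrightarrow>
    arm_path X A (n - Suc i) i x = arm_path X A (n - Suc (Suc i)) (Suc i) (mp X (A i, A (Suc i)) x)"
proof -
  assume "Suc i < n"
  then have "n - Suc i = Suc (n - Suc (Suc i))" by simp
  then show ?thesis by (simp only: arm_path.simps)
qed

lemma arm_path_embedding:
  assumes "vectorspace class_ring (sp X (A (i + k)))"
    and "\<And>j. i \<le> j \<Longrightarrow> j < i + k \<Longrightarrow>
      linear_map class_ring (sp X (A j)) (sp X (A (Suc j))) (mp X (A j, A (Suc j))) \<and>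
      inj_on (mp X (A j, A (Suc j))) (carrier (sp X (A j)))"
  shows "linear_map class_ring (sp X (A i)) (sp X (A (i + k))) (arm_path X A k i) \<and>
    inj_on (arm_path X A k i) (carrier (sp X (A i)))"
  using assms
proof (induction k arbitrary: i)
  case 0
  then show ?case by (simp add: linear_map_ident)
next
  case (Suc k)
  let ?m = "mp X (A i, A (Suc i))"
  have m: "linear_map class_ring (sp X (A i)) (sp X (A (Suc i))) ?m" "inj_on ?m (carrier (sp X (A i)))"
    using Suc.prems(2)[of i] by auto
  have IH: "linear_map class_ring (sp X (A (Suc i))) (sp X (A (i + Suc k))) (arm_path X A k (Suc i))"
      "inj_on (arm_path X A k (Suc i)) (carrier (sp X (A (Suc i))))"
    using Suc.IH[of "Suc i"] Suc.prems by auto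
  have "inj_on (arm_path X A k (Suc i) \<circ> ?m) (carrier (sp X (A i)))"
    using m by (intro comp_inj_on inj_on_subset[OF IH(2)]) (auto intro: linear_map_in)
  then show ?case
    using linear_map_comp[OF m(1) IH(1)] by (simp add: o_def)
qed


section \<open>Double flags are joint flags\<close>

text \<open>Inclusions and the canonical injections are injective, and the two summands of an external sum
  decompose it. For an empty arm the image is by convention the zero space, which agrees with the
  image of the zero summand under its injection; this allows both cases to be treated alike.\<close>

lemma double_flag_imp_joint_flag:
  fixes X :: "('k :: field, 'a) star_rep"
  assumes "double_flag r p q X"
  shows "joint_flag r p q X"
proof -
  from assms obtain V W where V: "fd_space V" and W: "fd_space W"
    and Delta: "sp X Delta = ext_sum V W"
    and Beta: "if p = 1 then carrier V = {\<zero>\<^bsub>V\<^esub>} else sp X (Beta (p - 1)) = V \<and>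
      mp X (Beta (p - 1), Delta) = (\<lambda>x \<in> carrier V. Pair x \<zero>\<^bsub>W\<^esub>)"
    and Gamma: "if q = 1 then carrier W = {\<zero>\<^bsub>W\<^esub>} else sp X (Gamma (q - 1)) = W \<and>
      mp X (Gamma (q - 1), Delta) = (\<lambda>x \<in> carrier W. Pair \<zero>\<^bsub>V\<^esub> x)"
    and incl: "\<And>e. e \<in> arcs (star_quiver r p q) \<Longrightarrow>
      e \<noteq> (Beta (p - 1), Delta) \<Longrightarrow> e \<noteq> (Gamma (q - 1), Delta) \<Longrightarrow> inclusion_arc X e"
    unfolding double_flag_def by blast
  have no_arc: "(A (1 - 1), Delta) \<notin> arcs (star_quiver r p q)"
    if "A = Beta \<and> p = 1 \<or> A = Gamma \<and> q = 1" for A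
    using that by (auto simp: arcs_star_quiver arm_arcs_def)
  have "inj_on (mp X e) (carrier (sp X (fst e)))" if e: "e \<in> arcs (star_quiver r p q)" for e
  proof -
    consider "e = (Beta (p - 1), Delta)" "p \<noteq> 1" | "e = (Gamma (q - 1), Delta)" "q \<noteq> 1"
      | "inclusion_arc X e"
      using incl[OF e] no_arc e by (cases "p = 1"; cases "q = 1") auto
    then show ?thesis
      by cases (use Beta Gamma in \<open>auto simp: inj_on_def inclusion_arc_def\<close>)
  qed
  moreover have "arm_image X Beta p = (\<lambda>x. Pair x \<zero>\<^bsub>W\<^esub>) ` carrier V"
    using Beta Delta by (auto simp: arm_image_def split: if_splits)
  moreover have "arm_image X Gamma q = (\<lambda>x. Pair \<zero>\<^bsub>V\<^esub> x) ` carrier W"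
    using Gamma Delta by (auto simp: arm_image_def split: if_splits)
  ultimately show ?thesis
    using V W Delta by (simp add: joint_flag_def internal_direct_sum_ext_sum fd_space_def)
qed


section \<open>Joint flags are isomorphic to double flags\<close>

text \<open>Every arm, empty or not, is given a space \<open>V\<close> embedded in the centre with the prescribed image.
  For an empty arm this is the zero subspace of the centre with its inclusion.\<close>

lemma arm_image_source:
  fixes X :: "('k :: field, 'a) star_rep"
  assumes X: "is_representation Q X" "wf_digraph Q" "tail Q = fst" "head Q = snd" "Delta \<in> verts Q"
    and arc: "n \<noteq> 1 \<Longrightarrow> (A (n - 1), Delta) \<in> arcs Q"
    and inj: "n \<noteq> 1 \<Longrightarrow> inj_on (mp X (A (n - 1), Delta)) (carrier (sp X (A (n - 1))))"
  obtains V f where "fd_space V" "linear_map class_ring V (sp X Delta) f" "inj_on f (carrier V)"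
    "f ` carrier V = arm_image X A n"
    "if n = 1 then carrier V = {\<zero>\<^bsub>V\<^esub>} else V = sp X (A (n - 1)) \<and> f = mp X (A (n - 1), Delta)"
proof (cases "n = 1")
  case True
  let ?U = "sp X Delta" and ?z = "\<lambda>x. \<zero>\<^bsub>sp X Delta\<^esub>"
  \<comment> \<open>As the image of the zero map the zero subspace is finite-dimensional.\<close>
  let ?V = "?U\<lparr>carrier := ?z ` carrier ?U\<rparr>"
  interpret vectorspace class_ring ?U using X by (intro representation_vectorspace)
  have U: "fd_space ?U" using X by (simp add: is_representation_def)
  have lin: "linear_map class_ring ?U ?U ?z"
    using vectorspace_axioms rmult_0 by (auto simp: linear_map_iff LinearCombinations.module_hom_def)
  have V: "carrier ?V = {\<zero>\<^bsub>?U\<^esub>}" by auto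
  have fd: "fd_space ?V" by (rule fd_space_image[OF U lin])
  have "linear_map class_ring ?V ?U (\<lambda>x. x)"
    using fd vectorspace_axioms by (auto simp: linear_map_iff LinearCombinations.module_hom_def fd_space_def)
  with fd V True show thesis
    by (intro that[of ?V "\<lambda>x. x"]) (auto simp: arm_image_def)
next
  case False
  then have "linear_map class_ring (sp X (A (n - 1))) (sp X Delta) (mp X (A (n - 1), Delta))"
      "fd_space (sp X (A (n - 1)))"
    using X arc wf_digraph.tail_in_verts[OF X(2) arc] by (fastforce simp: is_representation_def)+
  with False inj show thesis
    by (intro that) (auto simp: arm_image_def)
qed

text \<open>If the embedding of the source of an arrow factors through the arrow and the embedding of its
  target, then the transported map sends \<open>T (fst e) x\<close> to \<open>T (snd e) (mp X e x)\<close>, which is the same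
  element.\<close>

lemma transport_inclusion_arc:
  assumes e: "e \<in> arcs (star_quiver r p q)"
      "fst e \<in> verts (star_quiver r p q)" "snd e \<in> verts (star_quiver r p q)"
    and in_head: "\<And>x. x \<in> carrier (sp X (fst e)) \<Longrightarrow> mp X e x \<in> carrier (sp X (snd e))"
    and inj: "inj_on (T (fst e)) (carrier (sp X (fst e)))"
    and eq: "\<And>x. x \<in> carrier (sp X (fst e)) \<Longrightarrow> T (fst e) x = T (snd e) (mp X e x)"
  shows "inclusion_arc (transport (star_quiver r p q) X E T) e"
proof -
  let ?Y = "transport (star_quiver r p q) X E T"
  have "mp ?Y e = (\<lambda>y \<in> T (fst e) ` carrier (sp X (fst e)). y)"
  proof (rule extensionalityI)
    show "mp ?Y e \<in> extensional (T (fst e) ` carrier (sp X (fst e)))"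
      using mp_transport_extensional[OF e(1), of X E T] by simp
    fix y assume "y \<in> T (fst e) ` carrier (sp X (fst e))"
    then show "mp ?Y e y = (\<lambda>y \<in> T (fst e) ` carrier (sp X (fst e)). y) y"
      using mp_transport[OF e(1), of T X _ E] inj eq by auto
  qed simp
  moreover have "T (fst e) ` carrier (sp X (fst e)) \<subseteq> T (snd e) ` carrier (sp X (snd e))"
    using eq in_head by auto
  ultimately show ?thesis using e by (simp add: inclusion_arc_def)
qed

text \<open>The double flag is \<open>X\<close> transported along the embeddings that follow the arrows: to the centre
  and then by \<open>\<psi>\<close> into the external sum on the first arm, to the end of the arm on the other two.\<close>

lemma joint_flag_isomorphic_double_flag:
  fixes X :: "('k :: field, 'a) star_rep"
  assumes n: "r \<ge> 1" "p \<ge> 1" "q \<ge> 1"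
    and X: "is_representation (star_quiver r p q) X" and "joint_flag r p q X"
  obtains Y \<phi> where "is_representation (star_quiver r p q) Y" "double_flag r p q Y"
    "isomorphism_in (rep_category (star_quiver r p q)) X Y \<phi>"
proof -
  let ?Q = "star_quiver r p q"
  interpret Q: wf_digraph ?Q by (rule wf_star_quiver[OF n])
  have inj: "inj_on (mp X e) (carrier (sp X (fst e)))" if "e \<in> arcs ?Q" for e
    using that assms(5) by (simp add: joint_flag_def)
  have lin: "linear_map class_ring (sp X (fst e)) (sp X (snd e)) (mp X e)" if "e \<in> arcs ?Q" for e
    using that X by (simp add: is_representation_def)
  have arcBeta: "(Beta (p - 1), Delta) \<in> arcs ?Q" if "p \<noteq> 1"
    using that n by (auto simp: arcs_star_quiver arm_arcs_iff)
  obtain V f where V: "fd_space V" "linear_map class_ring V (sp X Delta) f" "inj_on f (carrier V)"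
      "f ` carrier V = arm_image X Beta p"
      "if p = 1 then carrier V = {\<zero>\<^bsub>V\<^esub>} else V = sp X (Beta (p - 1)) \<and> f = mp X (Beta (p - 1), Delta)"
    by (rule arm_image_source[where A = Beta and n = p,
          OF X Q.wf_digraph star_quiver_simps(1-3) arcBeta inj[OF arcBeta, simplified fst_conv]])
  have arcGamma: "(Gamma (q - 1), Delta) \<in> arcs ?Q" if "q \<noteq> 1"
    using that n by (auto simp: arcs_star_quiver arm_arcs_iff)
  obtain W g where W: "fd_space W" "linear_map class_ring W (sp X Delta) g" "inj_on g (carrier W)"
      "g ` carrier W = arm_image X Gamma q"
      "if q = 1 then carrier W = {\<zero>\<^bsub>W\<^esub>} else W = sp X (Gamma (q - 1)) \<and> g = mp X (Gamma (q - 1), Delta)"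
    by (rule arm_image_source[where A = Gamma and n = q,
          OF X Q.wf_digraph star_quiver_simps(1-3) arcGamma inj[OF arcGamma, simplified fst_conv]])
  have "internal_direct_sum (sp X Delta) (f ` carrier V) (g ` carrier W)"
    using assms(5) V(4) W(4) by (simp add: joint_flag_def)
  then obtain \<psi> where \<psi>: "linear_map class_ring (sp X Delta) (ext_sum V W) \<psi>"
    "bij_betw \<psi> (carrier (sp X Delta)) (carrier (ext_sum V W))"
    "\<And>x. x \<in> carrier V \<Longrightarrow> \<psi> (f x) = Pair x \<zero>\<^bsub>W\<^esub>"
    "\<And>x. x \<in> carrier W \<Longrightarrow> \<psi> (g x) = Pair \<zero>\<^bsub>V\<^esub> x"
    using internal_direct_sum_isomorphism[OF V(2,3) W(2,3)] by blast
  define E where "E = case_star_vertex (ext_sum V W) (\<lambda>_. ext_sum V W) (\<lambda>_. V) (\<lambda>_. W)"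
  define T where "T = case_star_vertex \<psi>
    (\<lambda>i x. \<psi> (mp X (Alpha (r - 1), Delta) (arm_path X Alpha (r - Suc i) i x)))
    (\<lambda>i. arm_path X Beta (p - Suc i) i) (\<lambda>i. arm_path X Gamma (q - Suc i) i)"
  have E [simp]: "E Delta = ext_sum V W" "E (Alpha i) = ext_sum V W" "E (Beta i) = V" "E (Gamma i) = W" for i
    by (simp_all add: E_def)
  have T: "T Delta = \<psi>"
      "T (Alpha i) = (\<lambda>x. \<psi> (mp X (Alpha (r - 1), Delta) (arm_path X Alpha (r - Suc i) i x)))"
      "T (Beta i) = arm_path X Beta (p - Suc i) i" "T (Gamma i) = arm_path X Gamma (q - Suc i) i" for i
    by (simp_all add: T_def)
  have path: "linear_map class_ring (sp X (A i)) (sp X (A (m - 1))) (arm_path X A (m - Suc i) i) \<and>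
      inj_on (arm_path X A (m - Suc i) i) (carrier (sp X (A i)))"
    if "arm_arcs A m \<subseteq> arcs ?Q" "A (m - 1) \<in> verts ?Q" "1 \<le> i" "i < m" for A m i
  proof -
    have arc: "(A j, A (Suc j)) \<in> arcs ?Q" if "i \<le> j" "Suc j < m" for j
    proof -
      have "(A j, A (Suc j)) \<in> arm_arcs A m" using that \<open>1 \<le> i\<close> by (intro arm_arcs_stepI) linarith+
      with \<open>arm_arcs A m \<subseteq> arcs ?Q\<close> show ?thesis by (rule subsetD)
    qed
    have len: "i + (m - Suc i) = m - 1" using \<open>i < m\<close> by simp
    have step: "linear_map class_ring (sp X (A j)) (sp X (A (Suc j))) (mp X (A j, A (Suc j))) \<and>
        inj_on (mp X (A j, A (Suc j))) (carrier (sp X (A j)))"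
      if "i \<le> j" "j < i + (m - Suc i)" for j
    proof -
      have "(A j, A (Suc j)) \<in> arcs ?Q" using that len by (intro arc) linarith+
      from lin[OF this] inj[OF this] show ?thesis by (simp only: fst_conv snd_conv simp_thms)
    qed
    have "vectorspace class_ring (sp X (A (i + (m - Suc i))))"
      unfolding len by (rule representation_vectorspace[OF X \<open>A (m - 1) \<in> verts ?Q\<close>])
    from arm_path_embedding[OF this step] show ?thesis unfolding len .
  qed
  have arms: "arm_arcs Alpha r \<subseteq> arcs ?Q" "arm_arcs Beta p \<subseteq> arcs ?Q" "arm_arcs Gamma q \<subseteq> arcs ?Q"
    unfolding arcs_star_quiver by blast+
  have ends: "(Alpha (r - 1), Delta) \<in> arcs ?Q" if "r > 1"
    using that by (auto simp: arcs_star_quiver arm_arcs_iff)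
  have T_embedding: "linear_map class_ring (sp X v) (E v) (T v) \<and> inj_on (T v) (carrier (sp X v))"
    if v: "v \<in> verts ?Q" for v
  proof (cases v)
    case Delta
    then show ?thesis using \<psi> by (simp add: T bij_betw_def)
  next
    case (Alpha i)
    then have i: "1 \<le> i" "i < r" using v by auto
    let ?m = "mp X (Alpha (r - 1), Delta)" and ?P = "arm_path X Alpha (r - Suc i) i"
    have P: "linear_map class_ring (sp X v) (sp X (Alpha (r - 1))) ?P" "inj_on ?P (carrier (sp X v))"
      using path[OF arms(1) _ i] i Alpha by simp_all
    have m: "linear_map class_ring (sp X (Alpha (r - 1))) (sp X Delta) ?m"
        "inj_on ?m (carrier (sp X (Alpha (r - 1))))"
      using lin[OF ends] inj[OF ends] i by simp_all
    have lin_comp: "linear_map class_ring (sp X v) (ext_sum V W) (\<lambda>x. \<psi> (?m (?P x)))"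
      by (rule linear_map_comp[OF linear_map_comp[OF P(1) m(1)] \<psi>(1)])
    have "inj_on (\<lambda>x. \<psi> (?m (?P x))) (carrier (sp X v))"
    proof (rule inj_onI)
      fix x y assume xy: "x \<in> carrier (sp X v)" "y \<in> carrier (sp X v)" "\<psi> (?m (?P x)) = \<psi> (?m (?P y))"
      note P_in = xy(1,2)[THEN linear_map_in[OF P(1)]]
      note m_in = P_in[THEN linear_map_in[OF m(1)]]
      have "?m (?P x) = ?m (?P y)"
        by (rule inj_onD[OF bij_betw_imp_inj_on[OF \<psi>(2)] xy(3) m_in])
      from inj_onD[OF m(2) this P_in] show "x = y" by (rule inj_onD[OF P(2) _ xy(1,2)])
    qed
    with lin_comp show ?thesis unfolding Alpha T E by blast
  next
    case (Beta i)
    then have i: "1 \<le> i" "i < p" using v by auto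
    then have "sp X (Beta (p - 1)) = V" using V(5) by simp
    then show ?thesis using path[OF arms(2) _ i] i Beta by (simp add: T)
  next
    case (Gamma i)
    then have i: "1 \<le> i" "i < q" using v by auto
    then have "sp X (Gamma (q - 1)) = W" using W(5) by simp
    then show ?thesis using path[OF arms(3) _ i] i Gamma by (simp add: T)
  qed
  let ?Y = "transport ?Q X E T"
  have Y: "is_representation ?Q ?Y" "\<exists>\<phi>. isomorphism_in (rep_category ?Q) X ?Y \<phi>"
    using transport_isomorphic[OF Q.wf_digraph X, of E T] T_embedding by blast+
  have "double_flag r p q ?Y"
    unfolding double_flag_def
  proof (intro conjI exI ballI)
    show "fd_space V" "fd_space W" by fact+
    \<comment> \<open>As \<open>\<psi>\<close> is onto, nothing is cut off from the external sum.\<close>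
    show "sp ?Y Delta = ext_sum V W"
      using \<psi>(2) by (simp add: T bij_betw_def del: ext_sum_simps)
    show "if p = 1 then carrier V = {\<zero>\<^bsub>V\<^esub>} else sp ?Y (Beta (p - 1)) = V \<and>
        mp ?Y (Beta (p - 1), Delta) = (\<lambda>x \<in> carrier V. Pair x \<zero>\<^bsub>W\<^esub>)"
    proof (cases "p = 1")
      case True
      then show ?thesis using V(5) by simp
    next
      case False
      then have arc: "(Beta (p - 1), Delta) \<in> arcs ?Q"
        and eq: "sp X (Beta (p - 1)) = V" "mp X (Beta (p - 1), Delta) = f"
        using arcBeta V(5) by simp_all
      \<comment> \<open>At the end of the arm there is no arrow left to follow.\<close>
      have id: "T (Beta (p - 1)) = (\<lambda>x. x)" using n by (simp add: T fun_eq_iff)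
      have "mp ?Y (Beta (p - 1), Delta) = (\<lambda>x \<in> carrier V. \<psi> (f x))"
        using mp_transport_fixed_tail[OF arc, of T X E, unfolded star_quiver_simps fst_conv snd_conv, OF id]
        by (simp only: eq T(1))
      also have "\<dots> = (\<lambda>x \<in> carrier V. Pair x \<zero>\<^bsub>W\<^esub>)"
        using \<psi>(3) by (rule restrict_ext)
      finally have "mp ?Y (Beta (p - 1), Delta) = (\<lambda>x \<in> carrier V. Pair x \<zero>\<^bsub>W\<^esub>)" .
      moreover have "Beta (p - 1) \<in> verts ?Q" using False n by simp
      then have "sp ?Y (Beta (p - 1)) = V" by (simp only: sp_transport eq E id image_ident) simp
      ultimately show ?thesis using False by simp
    qed
    show "if q = 1 then carrier W = {\<zero>\<^bsub>W\<^esub>} else sp ?Y (Gamma (q - 1)) = W \<and>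
        mp ?Y (Gamma (q - 1), Delta) = (\<lambda>x \<in> carrier W. Pair \<zero>\<^bsub>V\<^esub> x)"
    proof (cases "q = 1")
      case True
      then show ?thesis using W(5) by simp
    next
      case False
      then have arc: "(Gamma (q - 1), Delta) \<in> arcs ?Q"
        and eq: "sp X (Gamma (q - 1)) = W" "mp X (Gamma (q - 1), Delta) = g"
        using arcGamma W(5) by simp_all
      have id: "T (Gamma (q - 1)) = (\<lambda>x. x)" using n by (simp add: T fun_eq_iff)
      have "mp ?Y (Gamma (q - 1), Delta) = (\<lambda>x \<in> carrier W. \<psi> (g x))"
        using mp_transport_fixed_tail[OF arc, of T X E, unfolded star_quiver_simps fst_conv snd_conv, OF id]
        by (simp only: eq T(1))
      also have "\<dots> = (\<lambda>x \<in> carrier W. Pair \<zero>\<^bsub>V\<^esub> x)"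
        using \<psi>(4) by (rule restrict_ext)
      finally have "mp ?Y (Gamma (q - 1), Delta) = (\<lambda>x \<in> carrier W. Pair \<zero>\<^bsub>V\<^esub> x)" .
      moreover have "Gamma (q - 1) \<in> verts ?Q" using False n by simp
      then have "sp ?Y (Gamma (q - 1)) = W" by (simp only: sp_transport eq E id image_ident) simp
      ultimately show ?thesis using False by simp
    qed
    fix e assume "e \<in> arcs ?Q - {(Beta (p - 1), Delta), (Gamma (q - 1), Delta)}"
    then have e: "e \<in> arcs ?Q" "e \<noteq> (Beta (p - 1), Delta)" "e \<noteq> (Gamma (q - 1), Delta)" by auto
    consider i where "Suc i < r" "e = (Alpha i, Alpha (Suc i))" | "r > 1" "e = (Alpha (r - 1), Delta)"
      | i where "Suc i < p" "e = (Beta i, Beta (Suc i))" | i where "Suc i < q" "e = (Gamma i, Gamma (Suc i))"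
      using e n by (auto simp: arcs_star_quiver arm_arcs_iff)
    then have "T (fst e) x = T (snd e) (mp X e x)" for x
      by cases (simp_all add: T arm_path_step)
    then show "inclusion_arc ?Y e"
      using e Q.tail_in_verts[OF e(1)] Q.head_in_verts[OF e(1)] T_embedding representation_map_in[OF X e(1)]
      by (intro transport_inclusion_arc) auto
  qed
  with Y that show thesis by blast
qed

theorem proposition3p3:
  fixes r p q :: nat
  assumes "r \<ge> 1" and "p \<ge> 1" and "q \<ge> 1"
  shows "equivalent_categories
    (joint_flag_category r p q :: ('k :: {alg_closed_field, field_char_0}, 'a) star_cat)
    (double_flag_category r p q :: ('k, 'a) star_cat)"
  unfolding double_flag_category_def
proof (rule full_subcategory_equivalent)
  show "category (joint_flag_category r p q :: ('k, 'a) star_cat)"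
    unfolding joint_flag_category_def
    by (intro category_full_subcategory category_rep_category wf_star_quiver assms)
next
  fix X :: "('k, 'a) star_rep"
  assume "X \<in> Obj (joint_flag_category r p q)"
  then have "is_representation (star_quiver r p q) X" "joint_flag r p q X"
    by (simp_all add: joint_flag_category_def)
  from joint_flag_isomorphic_double_flag[OF assms this] obtain Y \<phi>
    where "is_representation (star_quiver r p q) Y" "double_flag r p q Y"
      "isomorphism_in (rep_category (star_quiver r p q)) X Y \<phi>" .
  then show "\<exists>Y \<in> Obj (joint_flag_category r p q). double_flag r p q Y \<and>
      (\<exists>f. isomorphism_in (joint_flag_category r p q) X Y f)"
    by (auto simp: joint_flag_category_def intro: double_flag_imp_joint_flag)
qed

end
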